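(* Let $(G,+,\partial)$ be an additive arithmetical semigroup satisfying axiom $\mathcal W_R$ for a positive integer $R$, and let $F$ be a Warlimont function on $G$ with normalization $\widetilde F$. Then for every positive integer $M$ there exist constants $\xi_1,\ldots,\xi_{R-1}$ such that, as $n\to\infty$, \[ \sum_{\partial(g)=n}(\widetilde F(g)-1)^M=\sum_{s=1}^{R-1}\xi_sG_{n-s}+O(G_{n-R}). \]
   Context: An additive arithmetical semigroup is a triple $(G,+,\partial)$ where $(G,+)$ is a commutative monoid (written additively) and $\partial:(G,+)\to(\mathbb Z_{\ge0},+)$ is a monoid homomorphism such that (i) $G_n:=\#\partial^{-1}(n)$ is finite for every $n$; (ii) $G$ is freely generated as a commutative monoid by a subset $G^+$ (the primes). Axiom $\mathcal W_R$ means: $G_{n-1}=o(G_n)$ and $\sum_{s=R}^{n-R}G_sG_{n-s}=O(G_{n-R})$. A function $F:G\to\mathbb R$ is multiplicative if $F(g_1+g_2)=F(g_1)F(g_2)$ whenever $g_1,g_2$ are coprime (have no prime in common in their decompositions); it is prime-independent if there is a sequence $\{F^+_n\}_{n\ge1}$ with $F(np)=F^+_n$ for every $p\in G^+$ and every $n\ge1$ (where $np=p+\cdots+p$, $n$ times). A Warlimont function is a non-negative, multiplicative, prime-independent $F$ with $\log(F^+_n)=O(n)$ and $F^+_1>0$. Its normalization is $\widetilde F(g)=F(g)/F^+_1$. *)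

theory Defs
  imports "HOL-Library.Multiset" "HOL-Library.Landau_Symbols"
begin

text \<open>The monoid \<open>G\<close> is the whole of a type of class \<open>comm_monoid_add\<close>, \<open>deg\<close> is the degree map
  and \<open>P\<close> is the set of primes.\<close>

text \<open>Free generation: each element is the sum of exactly one finite multiset of elements of \<open>P\<close>.\<close>

definition freely_generated_by :: "'a::comm_monoid_add set \<Rightarrow> bool" where
  "freely_generated_by P \<longleftrightarrow> bij_betw sum_mset {A. set_mset A \<subseteq> P} (UNIV :: 'a set)"

definition additive_arith_semigroup :: "('a::comm_monoid_add \<Rightarrow> nat) \<Rightarrow> 'a set \<Rightarrow> bool" where
  "additive_arith_semigroup deg P \<longleftrightarrow>
     deg 0 = 0 \<and> (\<forall>g h. deg (g + h) = deg g + deg h) \<and>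
     (\<forall>n. finite {g. deg g = n}) \<and>
     freely_generated_by P"

definition num_of_deg :: "('a \<Rightarrow> nat) \<Rightarrow> nat \<Rightarrow> nat" where
  "num_of_deg deg n = card {g. deg g = n}"

text \<open>The truncated subtractions only affect finitely many \<open>n\<close>, hence not the asymptotic
  relations.\<close>

definition axiom_W :: "nat \<Rightarrow> ('a \<Rightarrow> nat) \<Rightarrow> bool" where
  "axiom_W R deg \<longleftrightarrow>
     (\<lambda>n. real (num_of_deg deg (n - 1))) \<in> o(\<lambda>n. real (num_of_deg deg n)) \<and>
     (\<lambda>n. \<Sum>s=R..n-R. real (num_of_deg deg s) * real (num_of_deg deg (n - s)))
       \<in> O(\<lambda>n. real (num_of_deg deg (n - R)))"

definition prime_decomp :: "'a::comm_monoid_add set \<Rightarrow> 'a \<Rightarrow> 'a multiset" where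
  "prime_decomp P g = (THE A. set_mset A \<subseteq> P \<and> sum_mset A = g)"

definition coprime_elts :: "'a::comm_monoid_add set \<Rightarrow> 'a \<Rightarrow> 'a \<Rightarrow> bool" where
  "coprime_elts P g h \<longleftrightarrow> set_mset (prime_decomp P g) \<inter> set_mset (prime_decomp P h) = {}"

definition multiplicative_on :: "'a::comm_monoid_add set \<Rightarrow> ('a \<Rightarrow> real) \<Rightarrow> bool" where
  "multiplicative_on P F \<longleftrightarrow> (\<forall>g h. coprime_elts P g h \<longrightarrow> F (g + h) = F g * F h)"

text \<open>Prime independence with witnessing sequence \<open>Fp\<close>; the value \<open>Fp 0\<close> is irrelevant.\<close>

definition prime_independent :: "'a::comm_monoid_add set \<Rightarrow> ('a \<Rightarrow> real) \<Rightarrow> (nat \<Rightarrow> real) \<Rightarrow> bool" where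
  "prime_independent P F Fp \<longleftrightarrow> (\<forall>p\<in>P. \<forall>n\<ge>1. F (\<Sum>i<n. p) = Fp n)"

text \<open>Since \<open>ln 0 = 0\<close>, the growth condition does not exclude \<open>Fp n = 0\<close>: functions vanishing on
  some multiples of primes, such as the indicator function of the squarefree elements, are
  admitted.\<close>

definition warlimont_function :: "'a::comm_monoid_add set \<Rightarrow> ('a \<Rightarrow> real) \<Rightarrow> (nat \<Rightarrow> real) \<Rightarrow> bool" where
  "warlimont_function P F Fp \<longleftrightarrow>
     (\<forall>g. F g \<ge> 0) \<and> multiplicative_on P F \<and> prime_independent P F Fp \<and>
     (\<lambda>n. ln (Fp n)) \<in> O(\<lambda>n. real n) \<and> Fp 1 > 0"

definition normalization :: "('a \<Rightarrow> real) \<Rightarrow> (nat \<Rightarrow> real) \<Rightarrow> 'a \<Rightarrow> real" where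
  "normalization F Fp g = F g / Fp 1"

end

theory Submission imports Defs begin

text \<open>
  Almost all elements of degree \<open>n\<close> are a prime of degree greater than \<open>n - R\<close> plus an element of
  degree less than \<open>R\<close>. The remaining ones split into two parts of degree at least \<open>R\<close>, so axiom
  \<open>W\<^sub>R\<close> bounds their number by \<open>O(G\<^sub>n\<^sub>-\<^sub>R)\<close>, and the same holds for their number weighted by
  \<open>K ^ \<Omega>(g)\<close>, where \<open>\<Omega>\<close> counts primes with multiplicity, because the weighted number of all
  elements of degree \<open>n\<close> is still \<open>O(G\<^sub>n)\<close>. If \<open>g = p + h\<close> with \<open>p\<close> a large prime, the normalized
  function takes the value \<open>F h\<close> at \<open>g\<close>; hence the sum is a linear combination of the numbers of
  primes of degree \<open>n - j\<close>, \<open>j < R\<close>, where \<open>j = 0\<close> drops out because \<open>F 0 = 1\<close>. Applied to the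
  constant function \<open>1\<close>, the same argument yields a triangular system expressing these numbers of
  primes through the \<open>G\<^sub>n\<^sub>-\<^sub>s\<close>.
\<close>

text \<open>Adding members one at a time raises the total by less than \<open>R\<close> per step, so
  the first total that reaches \<open>R\<close> is still below \<open>2 * R\<close>.\<close>

lemma submultiset_sum_between:
  fixes d :: "'b \<Rightarrow> nat"
  assumes "R > 0" "\<And>x. x \<in># A \<Longrightarrow> d x < R" "R \<le> (\<Sum>x\<in>#A. d x)"
  shows "\<exists>B. B \<subseteq># A \<and> R \<le> (\<Sum>x\<in>#B. d x) \<and> (\<Sum>x\<in>#B. d x) < 2 * R"
  using assms
proof (induction A)
  case empty
  then show ?case by simp
next
  case (add x A)
  show ?case
  proof (cases "R \<le> (\<Sum>x\<in>#A. d x)")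
    case True
    then obtain B where "B \<subseteq># A" "R \<le> (\<Sum>x\<in>#B. d x)" "(\<Sum>x\<in>#B. d x) < 2 * R"
      using add by auto
    then show ?thesis
      using subset_mset.order_trans[of B A "add_mset x A"] by (intro exI[of _ B]) auto
  next
    case False
    moreover have "d x < R" using add.prems(2) by simp
    ultimately show ?thesis
      using add.prems(3) by (intro exI[of _ "add_mset x A"]) auto
  qed
qed

section \<open>Unique factorization, degrees and weighted counts\<close>

locale arith_semigroup =
  fixes deg :: "'a::comm_monoid_add \<Rightarrow> nat" and P :: "'a set"
  assumes semigroup: "additive_arith_semigroup deg P"
begin

abbreviation a :: "nat \<Rightarrow> real" where
  "a n \<equiv> real (num_of_deg deg n)"

definition num_primes :: "nat \<Rightarrow> real" where
  "num_primes n = real (card {p \<in> P. deg p = n})"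

text \<open>\<open>K ^ size\<close> is multiplicative over every splitting, coprime or not, which a
  Warlimont function need not be; it serves as a majorant of such functions.\<close>

definition weight :: "real \<Rightarrow> 'a \<Rightarrow> real" where
  "weight K g = K ^ size (prime_decomp P g)"

definition weight_sum :: "real \<Rightarrow> nat \<Rightarrow> real" where
  "weight_sum K n = (\<Sum>g | deg g = n. weight K g)"

lemma deg_0 [simp]: "deg 0 = 0" and deg_add [simp]: "deg (g + h) = deg g + deg h"
  and finite_deg [simp]: "finite {g. deg g = n}"
  using semigroup by (auto simp: additive_arith_semigroup_def)

lemma finite_deg_restrict [simp]: "finite {g. deg g = n \<and> Q g}" "finite {g. Q g \<and> deg g = n}"
  by (rule finite_subset[OF _ finite_deg[of n]]; blast)+

lemma deg_sum_mset: "deg (sum_mset A) = (\<Sum>x\<in>#A. deg x)"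
  by (induction A) auto

lemma prime_decomp_sum_mset [simp]:
  assumes "set_mset A \<subseteq> P"
  shows "prime_decomp P (sum_mset A) = A"
proof -
  have "inj_on sum_mset {A. set_mset A \<subseteq> P}"
    using semigroup by (auto simp: additive_arith_semigroup_def freely_generated_by_def bij_betw_def)
  then show ?thesis
    unfolding prime_decomp_def using assms by (intro the_equality) (auto dest: inj_onD)
qed

lemma sum_mset_exists: "\<exists>A. set_mset A \<subseteq> P \<and> sum_mset A = g"
proof -
  have "sum_mset ` {A. set_mset A \<subseteq> P} = UNIV"
    using semigroup by (auto simp: additive_arith_semigroup_def freely_generated_by_def bij_betw_def)
  then have "g \<in> sum_mset ` {A. set_mset A \<subseteq> P}" by simp
  then show ?thesis by blast
qed

lemma prime_decomp_primes: "set_mset (prime_decomp P g) \<subseteq> P"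
  and sum_mset_prime_decomp [simp]: "sum_mset (prime_decomp P g) = g"
  using sum_mset_exists[of g] prime_decomp_sum_mset by auto

lemma prime_decomp_0 [simp]: "prime_decomp P 0 = {#}"
  using prime_decomp_sum_mset[of "{#}"] by simp

lemma prime_decomp_eq_empty_iff [simp]: "prime_decomp P g = {#} \<longleftrightarrow> g = 0"
  by (metis prime_decomp_0 sum_mset.empty sum_mset_prime_decomp)

lemma prime_decomp_prime [simp]: "p \<in> P \<Longrightarrow> prime_decomp P p = {#p#}"
  using prime_decomp_sum_mset[of "{#p#}"] by simp

lemma prime_decomp_add [simp]: "prime_decomp P (g + h) = prime_decomp P g + prime_decomp P h"
  using prime_decomp_sum_mset[of "prime_decomp P g + prime_decomp P h"] prime_decomp_primes
  by simp

lemma deg_eq_sum_prime_decomp: "deg g = (\<Sum>p\<in>#prime_decomp P g. deg p)"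
  using deg_sum_mset[of "prime_decomp P g"] by simp

lemma obtain_split_prime:
  assumes "p \<in># prime_decomp P g"
  obtains h where "p \<in> P" "g = p + h"
proof
  show "p \<in> P" using assms prime_decomp_primes by blast
  have "g = sum_mset (add_mset p (prime_decomp P g - {#p#}))"
    using assms by (simp del: sum_mset.add_mset)
  then show "g = p + sum_mset (prime_decomp P g - {#p#})" by simp
qed

text \<open>By unique factorization the multiples of a prime are pairwise distinct; for a prime of
  degree 0 they would be infinitely many elements of degree 0.\<close>

lemma deg_prime_pos:
  assumes "p \<in> P"
  shows "deg p \<ge> 1"
proof (rule ccontr)
  assume "\<not> deg p \<ge> 1"
  then have "range (\<lambda>n. sum_mset (replicate_mset n p)) \<subseteq> {g. deg g = 0}"
    by (auto simp: deg_sum_mset)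
  moreover have "inj (\<lambda>n. sum_mset (replicate_mset n p))"
  proof (rule injI)
    fix m n assume "sum_mset (replicate_mset m p) = sum_mset (replicate_mset n p)"
    then have "prime_decomp P (sum_mset (replicate_mset m p)) =
        prime_decomp P (sum_mset (replicate_mset n p))"
      by simp
    moreover have "set_mset (replicate_mset k p) \<subseteq> P" for k using assms by auto
    ultimately have "replicate_mset m p = replicate_mset n p"
      using prime_decomp_sum_mset by metis
    then show "m = n" by (metis size_replicate_mset)
  qed
  ultimately show False
    using finite_deg[of 0] by (meson finite_imageD finite_subset infinite_UNIV_nat)
qed

lemma deg_eq_0_iff [simp]: "deg g = 0 \<longleftrightarrow> g = 0"
proof
  assume deg: "deg g = 0"
  show "g = 0"
  proof (rule ccontr)
    assume "g \<noteq> 0"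
    then have "prime_decomp P g \<noteq> {#}" by simp
    then obtain p where "p \<in># prime_decomp P g" by (rule multiset_nonemptyE)
    then obtain h where h: "p \<in> P" "g = p + h" by (rule obtain_split_prime)
    then show False using deg deg_prime_pos[of p] by simp
  qed
qed simp

lemma num_of_deg_0: "num_of_deg deg 0 = 1"
  by (simp add: num_of_deg_def)

lemma weight_add [simp]: "weight K (g + h) = weight K g * weight K h"
  by (simp add: weight_def power_add)

lemma weight_prime [simp]: "p \<in> P \<Longrightarrow> weight K p = K"
  by (simp add: weight_def)

lemma weight_nonneg: "K \<ge> 0 \<Longrightarrow> weight K g \<ge> 0"
  by (simp add: weight_def)

lemma weight_ge_1: "K \<ge> 1 \<Longrightarrow> weight K g \<ge> 1"
  by (simp add: weight_def)

lemma weight_sum_nonneg: "K \<ge> 0 \<Longrightarrow> weight_sum K n \<ge> 0"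
  unfolding weight_sum_def by (intro sum_nonneg weight_nonneg)

lemma num_primes_le: "num_primes n \<le> a n"
  unfolding num_primes_def num_of_deg_def by (intro of_nat_mono card_mono) auto

lemma num_primes_nonneg: "num_primes n \<ge> 0"
  by (simp add: num_primes_def)

text \<open>The map \<open>(s, x, y)\<close> to \<open>x + y\<close> covers \<open>S\<close>,
  possibly several times, so summing over all triples can only overcount. Multiplicativity of the
  weight then factors the sum for each \<open>s\<close>.\<close>

lemma sum_weight_le_split:
  assumes K: "K \<ge> 0" and T: "finite T" and S: "S \<subseteq> {g. deg g = n}"
    and split: "\<And>g. g \<in> S \<Longrightarrow> \<exists>x y. g = x + y \<and> x \<in> X \<and> deg x \<in> T"
  shows "(\<Sum>g\<in>S. weight K g) \<le>
    (\<Sum>s\<in>T. (\<Sum>x | x \<in> X \<and> deg x = s. weight K x) * weight_sum K (n - s))"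
proof -
  define D where "D = Sigma T (\<lambda>s. {x. x \<in> X \<and> deg x = s} \<times> {y. deg y = n - s})"
  define f :: "nat \<times> 'a \<times> 'a \<Rightarrow> 'a" where "f = (\<lambda>(s, x, y). x + y)"
  have D: "finite D" unfolding D_def by (intro finite_SigmaI T finite_cartesian_product) auto
  have "S \<subseteq> f ` D"
  proof
    fix g assume g: "g \<in> S"
    then obtain x y where "g = x + y" "x \<in> X" "deg x \<in> T" using split by blast
    moreover have "deg g = n" using g S by auto
    ultimately show "g \<in> f ` D"
      unfolding D_def f_def by (intro image_eqI[of _ _ "(deg x, x, y)"]) auto
  qed
  then have "(\<Sum>g\<in>S. weight K g) \<le> (\<Sum>g\<in>f ` D. weight K g)"
    using D K by (intro sum_mono2) (auto simp: weight_nonneg)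
  also have "\<dots> \<le> (\<Sum>z\<in>D. weight K (f z))"
    using D K sum_image_le[of D "weight K" f] by (simp add: weight_nonneg o_def)
  also have "\<dots> = (\<Sum>s\<in>T. \<Sum>z\<in>{x. x \<in> X \<and> deg x = s} \<times> {y. deg y = n - s}.
      weight K (fst z) * weight K (snd z))"
    unfolding D_def using T by (subst sum.Sigma) (auto simp: f_def intro!: sum.cong)
  also have "\<dots> = (\<Sum>s\<in>T. (\<Sum>x | x \<in> X \<and> deg x = s. weight K x) * weight_sum K (n - s))"
    unfolding weight_sum_def sum_product sum.cartesian_product
    by (intro sum.cong refl) auto
  finally show ?thesis .
qed

text \<open>Every element of positive degree contains a prime that can be split off. The resulting
  recursion drives the induction in \<open>weight_sum_bound\<close>.\<close>

lemma weight_sum_le: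
  assumes K: "K \<ge> 0" and n: "n \<ge> 1"
  shows "weight_sum K n \<le> K * (\<Sum>s=1..n. num_primes s * weight_sum K (n - s))"
proof -
  have "weight_sum K n \<le>
      (\<Sum>s=1..n. (\<Sum>x | x \<in> P \<and> deg x = s. weight K x) * weight_sum K (n - s))"
    unfolding weight_sum_def[of K n]
  proof (rule sum_weight_le_split[OF K])
    fix g assume "g \<in> {g. deg g = n}"
    then have "prime_decomp P g \<noteq> {#}" using n by auto
    then obtain p where "p \<in># prime_decomp P g" by (rule multiset_nonemptyE)
    then obtain h where h: "p \<in> P" "g = p + h" by (rule obtain_split_prime)
    then show "\<exists>x y. g = x + y \<and> x \<in> P \<and> deg x \<in> {1..n}"
      using deg_prime_pos[of p] \<open>g \<in> {g. deg g = n}\<close> by auto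
  qed auto
  also have "\<dots> = K * (\<Sum>s=1..n. num_primes s * weight_sum K (n - s))"
    by (simp add: num_primes_def sum_distrib_left mult_ac)
  finally show ?thesis .
qed

end

section \<open>Growth estimates from axiom W\<close>

locale arith_semigroup_W = arith_semigroup +
  fixes R :: nat
  assumes R: "R \<ge> 1" and W: "axiom_W R deg"
begin

lemma a_shift_smallo: "(\<lambda>n. a (n - Suc k)) \<in> o(\<lambda>n. a (n - k))"
proof -
  have "filterlim (\<lambda>n. n - k) at_top (at_top :: nat filter)"
    by (rule filterlim_minus_const_nat_at_top)
  then show ?thesis
    using W landau_o.small.compose[of "\<lambda>n. a (n - 1)" at_top a "\<lambda>n. n - k" at_top]
    by (simp add: axiom_W_def diff_diff_left)
qed

lemma a_shift_bigo: "l \<le> k \<Longrightarrow> (\<lambda>n. a (n - k)) \<in> O(\<lambda>n. a (n - l))"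
proof (induction k rule: dec_induct)
  case (step k)
  then show ?case
    using a_shift_smallo[of k] landau_o.big_trans landau_o.small_imp_big by blast
qed simp

lemma a_shift_smallo_0:
  assumes "k \<ge> 1"
  shows "(\<lambda>n. a (n - k)) \<in> o(a)"
  using landau_o.big_small_trans[OF a_shift_bigo[OF assms]] a_shift_smallo[of 0] by simp

lemma convolution_bigo:
  "(\<lambda>n. \<Sum>s=R..n-R. a s * a (n - s)) \<in> O(\<lambda>n. a (n - R))"
  using W by (simp add: axiom_W_def)

text \<open>The finitely many terms with \<open>s < R\<close> are each \<open>o(a)\<close>, and the
  axiom controls the rest. The range must stop short of \<open>n\<close>, since the term
  \<open>s = n\<close> equals \<open>a n\<close>.\<close>

lemma convolution_smallo: "(\<lambda>n. \<Sum>s=1..n-R. a s * a (n - s)) \<in> o(a)"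
proof -
  have "(\<lambda>n. (\<Sum>s=1..<R. a s * a (n - s)) + (\<Sum>s=R..n-R. a s * a (n - s))) \<in> o(a)"
  proof (intro sum_in_smallo)
    show "(\<lambda>n. \<Sum>s=1..<R. a s * a (n - s)) \<in> o(a)"
      by (intro big_sum_in_smallo) (auto intro: a_shift_smallo_0)
    show "(\<lambda>n. \<Sum>s=R..n-R. a s * a (n - s)) \<in> o(a)"
      using landau_o.big_small_trans[OF convolution_bigo a_shift_smallo_0[OF R]] .
  qed
  moreover have "eventually (\<lambda>n. (\<Sum>s=1..<R. a s * a (n - s)) + (\<Sum>s=R..n-R. a s * a (n - s)) =
      (\<Sum>s=1..n-R. a s * a (n - s))) at_top"
    using eventually_ge_at_top[of "2 * R"]
  proof eventually_elim
    case (elim n)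
    then have eq: "{1..n-R} = {1..<R} \<union> {R..n-R}" using R by auto
    show ?case unfolding eq by (rule sum.union_disjoint[symmetric]) auto
  qed
  ultimately show ?thesis by (rule landau_o.small.in_cong[THEN iffD1, rotated])
qed

text \<open>Strong induction on \<open>n\<close> through \<open>weight_sum_le\<close>: for large
  \<open>n\<close> the induction hypothesis enters only through the convolution up to
  \<open>n - R\<close>, which is small compared with \<open>a n\<close>.\<close>

lemma weight_sum_bound:
  assumes K: "K \<ge> 1"
  shows "\<exists>B\<ge>0. \<forall>n. weight_sum K n \<le> B * a n"
proof -
  have "(\<lambda>n. \<Sum>j<R. weight_sum K j * a (n - j)) \<in> O(a)"
    using a_shift_bigo[of 0] by (intro big_sum_in_bigo) auto
  then obtain D where D: "D > 0"
    and "eventually (\<lambda>n. norm (\<Sum>j<R. weight_sum K j * a (n - j)) \<le> D * norm (a n)) at_top"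
    by (rule landau_o.bigE)
  \<comment> \<open>With \<open>1 / (2 * K)\<close> the part governed by the induction hypothesis
    costs \<open>B / 2\<close> after the factor \<open>K\<close> of the recursion.\<close>
  moreover have "eventually (\<lambda>n. norm (\<Sum>s=1..n-R. a s * a (n - s)) \<le> 1 / (2 * K) * norm (a n))
      at_top"
    using K by (intro landau_o.smallD[OF convolution_smallo]) auto
  ultimately have "eventually (\<lambda>n. norm (\<Sum>j<R. weight_sum K j * a (n - j)) \<le> D * norm (a n) \<and>
      norm (\<Sum>s=1..n-R. a s * a (n - s)) \<le> 1 / (2 * K) * norm (a n) \<and> n \<ge> 2 * R) at_top"
    using eventually_ge_at_top[of "2 * R"] by (intro eventually_conj)
  then obtain N where N: "\<And>n. n \<ge> N \<Longrightarrow> norm (\<Sum>j<R. weight_sum K j * a (n - j)) \<le> D * norm (a n) \<and>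
      norm (\<Sum>s=1..n-R. a s * a (n - s)) \<le> 1 / (2 * K) * norm (a n) \<and> n \<ge> 2 * R"
    unfolding eventually_at_top_linorder by blast
  have nonneg: "weight_sum K m \<ge> 0" for m using K by (simp add: weight_sum_nonneg)
  \<comment> \<open>The first summand makes \<open>B / 2 + K * D \<le> B\<close>, which closes the
    induction step; the second covers all \<open>n < N\<close> at once.\<close>
  define B where "B = 2 * K * D + (\<Sum>m<N. weight_sum K m)"
  have "(\<Sum>m<N. weight_sum K m) \<ge> 0" by (intro sum_nonneg nonneg)
  then have B: "B \<ge> 2 * K * D" "B \<ge> 0" unfolding B_def using K D by auto
  have "weight_sum K n \<le> B * a n" for n
  proof (induction n rule: less_induct)
    case (less n)
    show ?case
    proof (cases "n < N")
      case True
      then have "weight_sum K n \<le> (\<Sum>m<N. weight_sum K m)"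
        by (intro member_le_sum) (auto simp: nonneg)
      then have le: "weight_sum K n \<le> B" unfolding B_def using K D by (smt (verit) mult_nonneg_nonneg)
      \<comment> \<open>A degree may be empty, making the right side 0, but then the weighted sum is
        0 too; otherwise \<open>a n \<ge> 1\<close>.\<close>
      show ?thesis
      proof (cases "{g. deg g = n} = {}")
        case True
        then show ?thesis by (simp add: weight_sum_def num_of_deg_def)
      next
        case False
        then have "a n \<ge> 1" by (simp add: num_of_deg_def card_gt_0_iff Suc_le_eq)
        then show ?thesis using le B(2) by (smt (verit) mult_left_le mult_le_cancel_left1)
      qed
    next
      case False
      then have "n \<ge> N" by simp
      note N = N[OF this]
      \<comment> \<open>For the last \<open>R\<close> values of \<open>s\<close> the cofactor has
        degree \<open>j = n - s < R\<close>, so its weighted sum is one of finitely many constants;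
        this part is bounded by \<open>D * a n\<close>.\<close>
      have eq: "{1..n} = {1..n-R} \<union> {n-R<..n}" using N R by auto
      have "(\<Sum>s=1..n. num_primes s * weight_sum K (n - s)) \<le> (\<Sum>s=1..n. a s * weight_sum K (n - s))"
        by (intro sum_mono mult_right_mono num_primes_le nonneg)
      also have "\<dots> = (\<Sum>s=1..n-R. a s * weight_sum K (n - s))
          + (\<Sum>s\<in>{n-R<..n}. a s * weight_sum K (n - s))"
        unfolding eq by (intro sum.union_disjoint) auto
      also have "(\<Sum>s\<in>{n-R<..n}. a s * weight_sum K (n - s)) = (\<Sum>j<R. weight_sum K j * a (n - j))"
        using N by (intro sum.reindex_bij_witness[of _ "\<lambda>j. n - j" "\<lambda>s. n - s"]) auto
      also have "\<dots> \<le> D * a n" using N by (auto simp: abs_le_iff)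
      also have "(\<Sum>s=1..n-R. a s * weight_sum K (n - s)) \<le> (\<Sum>s=1..n-R. a s * (B * a (n - s)))"
        using less N R by (intro sum_mono mult_left_mono) auto
      also have "\<dots> = B * (\<Sum>s=1..n-R. a s * a (n - s))"
        by (simp add: sum_distrib_left mult_ac)
      also have "\<dots> \<le> B * (1 / (2 * K) * a n)"
        using N B(2) by (intro mult_left_mono) auto
      finally have "K * (\<Sum>s=1..n. num_primes s * weight_sum K (n - s)) \<le>
          K * (B * (1 / (2 * K) * a n) + D * a n)"
        using K by (intro mult_left_mono) auto
      also have "\<dots> = (B / 2 + K * D) * a n" using K by (simp add: field_simps)
      also have "\<dots> \<le> B * a n" using B(1) by (intro mult_right_mono) auto
      finally show ?thesis
        using weight_sum_le[of K n] K N R by simp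
    qed
  qed
  then show ?thesis using B(2) by blast
qed

section \<open>Elements without and with a prime of large degree\<close>

text \<open>Each such element has a part \<open>x\<close> with
  \<open>R \<le> deg x \<le> n - R\<close>: a single prime of degree at least \<open>R\<close>, or
  else a sum of smaller primes found by \<open>submultiset_sum_between\<close>. The weighted count
  is thus at most \<open>B\<^sup>2\<close> times the convolution in the axiom.\<close>

lemma sum_weight_small_primes_bigo:
  assumes K: "K \<ge> 1"
  shows "(\<lambda>n. \<Sum>g | deg g = n \<and> (\<forall>p\<in>#prime_decomp P g. deg p \<le> n - R). weight K g)
    \<in> O(\<lambda>n. a (n - R))"
proof -
  obtain B where B: "B \<ge> 0" "\<And>n. weight_sum K n \<le> B * a n"
    using weight_sum_bound[OF K] by blast
  have "eventually (\<lambda>n. norm (\<Sum>g | deg g = n \<and> (\<forall>p\<in>#prime_decomp P g. deg p \<le> n - R). weight K g)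
      \<le> B\<^sup>2 * norm (\<Sum>s=R..n-R. a s * a (n - s))) at_top"
    using eventually_ge_at_top[of "3 * R"]
  proof eventually_elim
    case (elim n)
    let ?S = "{g. deg g = n \<and> (\<forall>p\<in>#prime_decomp P g. deg p \<le> n - R)}"
    have "(\<Sum>g\<in>?S. weight K g) \<le>
        (\<Sum>s=R..n-R. (\<Sum>x | x \<in> UNIV \<and> deg x = s. weight K x) * weight_sum K (n - s))"
    proof (rule sum_weight_le_split)
      fix g assume g: "g \<in> ?S"
      show "\<exists>x y. g = x + y \<and> x \<in> UNIV \<and> deg x \<in> {R..n-R}"
      proof (cases "\<exists>p\<in>#prime_decomp P g. deg p \<ge> R")
        case True
        then obtain p where p: "p \<in># prime_decomp P g" "deg p \<ge> R" by blast
        from p(1) obtain h where "g = p + h" by (rule obtain_split_prime)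
        then show ?thesis using p g by auto
      next
        case False
        then obtain A where A: "A \<subseteq># prime_decomp P g" "R \<le> (\<Sum>x\<in>#A. deg x)" "(\<Sum>x\<in>#A. deg x) < 2 * R"
          using submultiset_sum_between[of R "prime_decomp P g" deg] R g elim
          by (auto simp: deg_eq_sum_prime_decomp[symmetric] not_le)
        have "g = sum_mset A + sum_mset (prime_decomp P g - A)"
          using A(1) by (metis sum_mset.union subset_mset.add_diff_inverse sum_mset_prime_decomp)
        \<comment> \<open>Here \<open>n \<ge> 3 * R\<close> enters: a degree below
          \<open>2 * R\<close> is at most \<open>n - R\<close>.\<close>
        moreover have "deg (sum_mset A) \<in> {R..n-R}"
          using A elim by (auto simp: deg_sum_mset)
        ultimately show ?thesis by blast
      qed
    qed (use K in auto)
    also have "\<dots> = (\<Sum>s=R..n-R. weight_sum K s * weight_sum K (n - s))"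
      by (simp add: weight_sum_def)
    also have "\<dots> \<le> (\<Sum>s=R..n-R. (B * a s) * (B * a (n - s)))"
      using B K by (intro sum_mono mult_mono) (auto simp: weight_sum_nonneg)
    also have "\<dots> = B\<^sup>2 * (\<Sum>s=R..n-R. a s * a (n - s))"
      by (simp add: sum_distrib_left power2_eq_square mult_ac)
    finally show ?case
      using K by (simp add: sum_nonneg weight_nonneg)
  qed
  then have "(\<lambda>n. \<Sum>g | deg g = n \<and> (\<forall>p\<in>#prime_decomp P g. deg p \<le> n - R). weight K g)
      \<in> O(\<lambda>n. \<Sum>s=R..n-R. a s * a (n - s))"
    by (rule bigoI)
  then show ?thesis using convolution_bigo by (rule landau_o.big_trans)
qed

text \<open>Since \<open>n \<ge> 2 * R\<close>, a prime of degree above \<open>n - R\<close> exceeds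
  the degree of its cofactor \<open>h\<close>. So it occurs once, is determined by the element, and
  is coprime to \<open>h\<close>; the identity is exact.\<close>

lemma sum_large_prime:
  fixes \<phi> \<psi> :: "'a \<Rightarrow> real"
  assumes \<phi>: "\<And>p h. p \<in> P \<Longrightarrow> p \<notin># prime_decomp P h \<Longrightarrow> \<phi> (p + h) = \<psi> h"
    and n: "n \<ge> 2 * R"
  shows "(\<Sum>g | deg g = n \<and> \<not> (\<forall>p\<in>#prime_decomp P g. deg p \<le> n - R). \<phi> g) =
    (\<Sum>j<R. (\<Sum>h | deg h = j. \<psi> h) * num_primes (n - j))"
proof -
  let ?S = "{g. deg g = n \<and> \<not> (\<forall>p\<in>#prime_decomp P g. deg p \<le> n - R)}"
  define D where "D = Sigma {..<R} (\<lambda>j. {p. p \<in> P \<and> deg p = n - j} \<times> {h. deg h = j})"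
  define f :: "nat \<times> 'a \<times> 'a \<Rightarrow> 'a" where "f = (\<lambda>(j, p, h). p + h)"
  have notin: "p \<notin># prime_decomp P h" if "deg p > deg h" for p h
  proof
    assume "p \<in># prime_decomp P h"
    then obtain k where "h = p + k" by (rule obtain_split_prime)
    then show False using that by simp
  qed
  have "inj_on f D"
  proof (rule inj_onI)
    fix z z' assume z: "z \<in> D" "z' \<in> D" "f z = f z'"
    obtain j p h j' p' h' where eq: "z = (j, p, h)" "z' = (j', p', h')"
      by (metis prod.exhaust)
    have p: "p \<in> P" "p' \<in> P" and d: "deg h = j" "j < R" "deg p = n - j" "deg h' = j'" "j' < R"
      "deg p' = n - j'"
      using z(1,2) unfolding eq D_def by auto
    have "prime_decomp P (p + h) = prime_decomp P (p' + h')"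
      using z(3) unfolding eq f_def by simp
    then have pd: "add_mset p (prime_decomp P h) = add_mset p' (prime_decomp P h')"
      using p by simp
    \<comment> \<open>\<open>p\<close> has degree above \<open>n - R\<close>, hence above
      \<open>deg h'\<close>, so \<open>pd\<close> leaves only \<open>p'\<close> to match it.\<close>
    have "p \<notin># prime_decomp P h'" using d n by (intro notin) auto
    then have pp: "p = p'" using pd by (metis insert_noteq_member)
    then have "prime_decomp P h = prime_decomp P h'" using pd by simp
    then have "h = h'" by (metis sum_mset_prime_decomp)
    then show "z = z'" using pp d eq by simp
  qed
  moreover have "f ` D = ?S"
  proof (intro equalityI subsetI)
    fix g assume "g \<in> f ` D"
    then obtain j p h where "g = p + h" "p \<in> P" "deg p = n - j" "deg h = j" "j < R"
      unfolding f_def D_def by auto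
    then show "g \<in> ?S" using n by auto
  next
    fix g assume g: "g \<in> ?S"
    then obtain p where p: "p \<in># prime_decomp P g" "deg p > n - R" by (auto simp: not_le)
    from p(1) obtain h where h: "p \<in> P" "g = p + h" by (rule obtain_split_prime)
    then have "(deg h, p, h) \<in> D" using g p n unfolding D_def by auto
    then show "g \<in> f ` D" unfolding f_def h(2) by (intro image_eqI[of _ _ "(deg h, p, h)"]) auto
  qed
  ultimately have "(\<Sum>g\<in>?S. \<phi> g) = (\<Sum>z\<in>D. \<phi> (f z))"
    using sum.reindex[of f D \<phi>] by simp
  also have "\<dots> = (\<Sum>z\<in>D. \<psi> (snd (snd z)))"
  proof (rule sum.cong)
    fix z assume "z \<in> D"
    then obtain j p h where "z = (j, p, h)" "p \<in> P" "deg p = n - j" "deg h = j" "j < R"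
      unfolding D_def by auto
    moreover from this have "p \<notin># prime_decomp P h" using n by (intro notin) auto
    ultimately show "\<phi> (f z) = \<psi> (snd (snd z))" by (simp add: f_def \<phi>)
  qed simp
  also have "\<dots> = (\<Sum>j<R. \<Sum>z\<in>{p. p \<in> P \<and> deg p = n - j} \<times> {h. deg h = j}. \<psi> (snd z))"
    unfolding D_def by (subst sum.Sigma) (auto intro!: sum.cong)
  also have "\<dots> = (\<Sum>j<R. \<Sum>p | p \<in> P \<and> deg p = n - j. \<Sum>h | deg h = j. \<psi> h)"
    unfolding sum.cartesian_product by (intro sum.cong refl) auto
  also have "\<dots> = (\<Sum>j<R. (\<Sum>h | deg h = j. \<psi> h) * num_primes (n - j))"
    by (simp add: num_primes_def mult.commute)
  finally show ?thesis .
qed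

lemma sum_num_primes_expansion:
  fixes \<phi> \<psi> :: "'a \<Rightarrow> real"
  assumes \<phi>: "\<And>p h. p \<in> P \<Longrightarrow> p \<notin># prime_decomp P h \<Longrightarrow> \<phi> (p + h) = \<psi> h"
    and K: "K \<ge> 1" and bound: "\<And>g. \<bar>\<phi> g\<bar> \<le> C * weight K g"
  shows "(\<lambda>n. (\<Sum>g | deg g = n. \<phi> g) - (\<Sum>j<R. (\<Sum>h | deg h = j. \<psi> h) * num_primes (n - j)))
    \<in> O(\<lambda>n. a (n - R))"
proof -
  let ?small = "\<lambda>n g. \<forall>p\<in>#prime_decomp P g. deg p \<le> n - R"
  have "eventually (\<lambda>n. norm ((\<Sum>g | deg g = n. \<phi> g) -
      (\<Sum>j<R. (\<Sum>h | deg h = j. \<psi> h) * num_primes (n - j)))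
      \<le> C * norm (\<Sum>g | deg g = n \<and> ?small n g. weight K g)) at_top"
    using eventually_ge_at_top[of "2 * R"]
  proof eventually_elim
    case (elim n)
    have "{g. deg g = n} = {g. deg g = n \<and> ?small n g} \<union> {g. deg g = n \<and> \<not> ?small n g}" by blast
    then have "(\<Sum>g | deg g = n. \<phi> g) =
        (\<Sum>g | deg g = n \<and> ?small n g. \<phi> g) + (\<Sum>g | deg g = n \<and> \<not> ?small n g. \<phi> g)"
      by (simp only:) (rule sum.union_disjoint; auto)
    also have "(\<Sum>g | deg g = n \<and> \<not> ?small n g. \<phi> g) =
        (\<Sum>j<R. (\<Sum>h | deg h = j. \<psi> h) * num_primes (n - j))"
      by (rule sum_large_prime) (use \<phi> elim in auto)
    finally have "norm ((\<Sum>g | deg g = n. \<phi> g) -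
        (\<Sum>j<R. (\<Sum>h | deg h = j. \<psi> h) * num_primes (n - j)))
        = \<bar>\<Sum>g | deg g = n \<and> ?small n g. \<phi> g\<bar>" by simp
    also have "\<dots> \<le> (\<Sum>g | deg g = n \<and> ?small n g. C * weight K g)"
      by (intro order_trans[OF sum_abs] sum_mono bound)
    also have "\<dots> = C * norm (\<Sum>g | deg g = n \<and> ?small n g. weight K g)"
      using K by (simp add: sum_distrib_left sum_nonneg weight_nonneg)
    finally show ?case .
  qed
  then have "(\<lambda>n. (\<Sum>g | deg g = n. \<phi> g) - (\<Sum>j<R. (\<Sum>h | deg h = j. \<psi> h) * num_primes (n - j)))
      \<in> O(\<lambda>n. \<Sum>g | deg g = n \<and> ?small n g. weight K g)"
    by (rule bigoI)
  then show ?thesis by (rule landau_o.big_trans[OF _ sum_weight_small_primes_bigo[OF K]])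
qed

section \<open>Expansions in shifted counts\<close>

text \<open>The sum starts at \<open>s = 1\<close>, so a term in \<open>a n\<close> itself is not
  allowed; hence the conditions \<open>k \<ge> 1\<close> and \<open>\<psi> 0 = 0\<close>
  below.\<close>

definition expandable :: "(nat \<Rightarrow> real) \<Rightarrow> bool" where
  "expandable u \<longleftrightarrow> (\<exists>\<xi> :: nat \<Rightarrow> real.
     (\<lambda>n. u n - (\<Sum>s=1..R-1. \<xi> s * a (n - s))) \<in> O(\<lambda>n. a (n - R)))"

lemma expandable_bigo:
  assumes "u \<in> O(\<lambda>n. a (n - R))"
  shows "expandable u"
  unfolding expandable_def using assms by (intro exI[of _ "\<lambda>_. 0"]) simp

lemma expandable_add:
  assumes "expandable u" "expandable v"
  shows "expandable (\<lambda>n. u n + v n)"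
proof -
  obtain \<xi> \<eta> where "(\<lambda>n. u n - (\<Sum>s=1..R-1. \<xi> s * a (n - s))) \<in> O(\<lambda>n. a (n - R))"
    "(\<lambda>n. v n - (\<Sum>s=1..R-1. \<eta> s * a (n - s))) \<in> O(\<lambda>n. a (n - R))"
    using assms unfolding expandable_def by blast
  from sum_in_bigo(1)[OF this] show ?thesis
    unfolding expandable_def
    by (intro exI[of _ "\<lambda>s. \<xi> s + \<eta> s"]) (simp add: algebra_simps sum.distrib)
qed

lemma expandable_cmult:
  assumes "expandable u"
  shows "expandable (\<lambda>n. c * u n)"
proof -
  obtain \<xi> where "(\<lambda>n. u n - (\<Sum>s=1..R-1. \<xi> s * a (n - s))) \<in> O(\<lambda>n. a (n - R))"
    using assms unfolding expandable_def by blast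
  then have "(\<lambda>n. c * (u n - (\<Sum>s=1..R-1. \<xi> s * a (n - s)))) \<in> O(\<lambda>n. a (n - R))"
    by (cases "c = 0") simp_all
  then show ?thesis
    unfolding expandable_def
    by (intro exI[of _ "\<lambda>s. c * \<xi> s"]) (simp add: algebra_simps sum_distrib_left)
qed

lemma expandable_sum:
  "(\<And>i. i \<in> I \<Longrightarrow> expandable (u i)) \<Longrightarrow> expandable (\<lambda>n. \<Sum>i\<in>I. u i n)"
proof (induction I rule: infinite_finite_induct)
  case (insert i I)
  then show ?case using expandable_add[of "u i" "\<lambda>n. \<Sum>i\<in>I. u i n"] by simp
qed (auto intro: expandable_bigo)

lemma expandable_a:
  assumes "k \<ge> 1"
  shows "expandable (\<lambda>n. a (n - k))"
proof (cases "k < R")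
  case True
  have "(\<Sum>s=1..R-1. (if s = k then 1 else 0) * a (n - s)) = a (n - k)" for n
  proof -
    have "(\<Sum>s=1..R-1. (if s = k then 1 else 0) * a (n - s)) =
        (\<Sum>s=1..R-1. if s = k then a (n - s) else 0)"
      by (intro sum.cong) auto
    then show ?thesis using True assms by (auto simp: sum.delta)
  qed
  then show ?thesis
    unfolding expandable_def by (intro exI[of _ "\<lambda>s. if s = k then 1 else 0"]) simp
next
  case False
  then show ?thesis by (intro expandable_bigo a_shift_bigo) simp
qed

text \<open>With \<open>\<phi> = \<psi> = 1\<close> the previous expansion has leading coefficient
  \<open>a 0 = 1\<close>, so it can be solved for \<open>num_primes (n - k)\<close>. Only shifts
  \<open>k + j > k\<close> remain, whence induction on \<open>R - k\<close>; shifts of at least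
  \<open>R\<close> go into the error term.\<close>

lemma expandable_num_primes:
  assumes "k \<ge> 1"
  shows "expandable (\<lambda>n. num_primes (n - k))"
  using assms
proof (induction "R - k" arbitrary: k rule: less_induct)
  case less
  show ?case
  proof (cases "k < R")
    case False
    have "(\<lambda>n. num_primes (n - k)) \<in> O(\<lambda>n. a (n - k))"
      using num_primes_le num_primes_nonneg by (intro landau_o.big_mono) (auto intro!: always_eventually)
    then show ?thesis
      using False landau_o.big_trans a_shift_bigo[of R k] by (blast intro: expandable_bigo leI)
  next
    case True
    let ?r = "\<lambda>n. a n - (\<Sum>j<R. a j * num_primes (n - j))"
    have "?r \<in> O(\<lambda>n. a (n - R))"
      using sum_num_primes_expansion[of "\<lambda>_. 1" "\<lambda>_. 1" 1 1]
      by (simp add: weight_def num_of_deg_def)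
    moreover have "filterlim (\<lambda>n. n - k) at_top (at_top :: nat filter)"
      by (rule filterlim_minus_const_nat_at_top)
    ultimately have "(\<lambda>n. ?r (n - k)) \<in> O(\<lambda>n. a (n - k - R))"
      by (rule landau_o.big.compose)
    also have "(\<lambda>n. a (n - k - R)) \<in> O(\<lambda>n. a (n - R))"
      using a_shift_bigo[of R "k + R"] by simp
    finally have r: "expandable (\<lambda>n. ?r (n - k))" by (rule expandable_bigo)
    have "expandable (\<lambda>n. \<Sum>j=1..<R. a j * num_primes (n - (k + j)))"
      using less True by (intro expandable_sum expandable_cmult less) auto
    \<comment> \<open>Once the \<open>j = 0\<close> term is separated from the sum inside
      \<open>?r\<close>, this combination collapses to \<open>num_primes (n - k)\<close>.\<close>
    from expandable_add[OF expandable_add[OF expandable_a[OF less.prems]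
          expandable_cmult[OF this, of "-1"]] expandable_cmult[OF r, of "-1"]]
    have "expandable (\<lambda>n. a (n - k) + -1 * (\<Sum>j=1..<R. a j * num_primes (n - (k + j)))
        + -1 * ?r (n - k))" .
    moreover have "(\<Sum>j<R. a j * num_primes (n - k - j)) =
        num_primes (n - k) + (\<Sum>j=1..<R. a j * num_primes (n - (k + j)))" for n
    proof -
      have "{..<R} = insert 0 {1..<R}" using R by auto
      then show ?thesis by (simp add: num_of_deg_0)
    qed
    ultimately show ?thesis by simp
  qed
qed

text \<open>The term \<open>j = 0\<close> is \<open>\<psi> 0 * num_primes n\<close>, the one term
  that \<open>expandable_num_primes\<close> does not cover; \<open>\<psi> 0 = 0\<close> removes
  it.\<close>

lemma expandable_sum_coprime_shift:
  fixes \<phi> \<psi> :: "'a \<Rightarrow> real"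
  assumes \<phi>: "\<And>p h. p \<in> P \<Longrightarrow> p \<notin># prime_decomp P h \<Longrightarrow> \<phi> (p + h) = \<psi> h"
    and K: "K \<ge> 1" and bound: "\<And>g. \<bar>\<phi> g\<bar> \<le> C * weight K g"
    and \<psi>: "\<psi> 0 = 0"
  shows "expandable (\<lambda>n. \<Sum>g | deg g = n. \<phi> g)"
proof -
  let ?c = "\<lambda>j. \<Sum>h | deg h = j. \<psi> h"
  have c0: "?c 0 = 0" using \<psi> by simp
  have "expandable (\<lambda>n. \<Sum>j\<in>{1..<R}. ?c j * num_primes (n - j))"
    by (intro expandable_sum expandable_cmult expandable_num_primes) auto
  moreover have "(\<Sum>j<R. ?c j * num_primes (n - j)) = (\<Sum>j\<in>{1..<R}. ?c j * num_primes (n - j))" for n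
    using c0 by (intro sum.mono_neutral_right) (auto simp: not_less_eq_eq)
  ultimately have "expandable (\<lambda>n. \<Sum>j<R. ?c j * num_primes (n - j))" by simp
  from expandable_add[OF this expandable_bigo[OF sum_num_primes_expansion[of \<phi> \<psi> K C]]]
  show ?thesis using \<phi> K bound by simp
qed

end

section \<open>Majorizing Warlimont functions\<close>

lemma log_bounded_imp_power_bound:
  fixes u :: "nat \<Rightarrow> real"
  assumes "(\<lambda>n. ln (u n)) \<in> O(\<lambda>n. real n)"
  shows "\<exists>K\<ge>1. \<forall>n\<ge>1. u n \<le> K ^ n"
proof -
  obtain c where "c > 0" and "eventually (\<lambda>n. norm (ln (u n)) \<le> c * norm (real n)) at_top"
    using assms by (rule landau_o.bigE)
  then obtain N where N: "\<And>n. n \<ge> N \<Longrightarrow> \<bar>ln (u n)\<bar> \<le> c * real n"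
    unfolding eventually_at_top_linorder by auto
  \<comment> \<open>\<open>exp c\<close> serves for \<open>n \<ge> N\<close>, and the sum for the
    finitely many smaller \<open>n\<close>, where \<open>K \<le> K ^ n\<close> because
    \<open>n \<ge> 1\<close>.\<close>
  define K where "K = exp c + (\<Sum>n<N. \<bar>u n\<bar>)"
  have s: "(\<Sum>n<N. \<bar>u n\<bar>) \<ge> 0" by (intro sum_nonneg) auto
  have "exp c \<ge> 1" using \<open>c > 0\<close> by simp
  then have K: "K \<ge> 1" "K \<ge> exp c" unfolding K_def using s by linarith+
  have "u n \<le> K ^ n" if "n \<ge> 1" for n
  proof (cases "n < N")
    case True
    then have "\<bar>u n\<bar> \<le> (\<Sum>n<N. \<bar>u n\<bar>)" by (intro member_le_sum) auto
    then have "u n \<le> K" unfolding K_def using exp_gt_zero[of c] by linarith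
    also have "K \<le> K ^ n" using K that by (intro self_le_power) auto
    finally show ?thesis .
  next
    case False
    show ?thesis
    proof (cases "u n > 0")
      case True
      then have "u n = exp (ln (u n))" by simp
      also have "\<dots> \<le> exp (real n * c)" using N[of n] False by (simp add: mult.commute)
      also have "\<dots> = exp c ^ n" by (simp add: exp_of_nat_mult)
      also have "\<dots> \<le> K ^ n" using K by (intro power_mono) auto
      finally show ?thesis .
    next
      case False
      then show ?thesis using K zero_le_power[of K n] by linarith
    qed
  qed
  then show ?thesis using K by blast
qed

context arith_semigroup
begin

text \<open>Induction on the number of primes. All copies of a prime are removed together, because
  \<open>F\<close> factors only over coprime parts; the block of \<open>n\<close> copies contributes
  \<open>Fp n \<le> K ^ n\<close>.\<close>

lemma prime_independent_le_weight:
  assumes mult: "multiplicative_on P F" and ind: "prime_independent P F Fp"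
    and nonneg: "\<And>g. F g \<ge> 0" and F0: "F 0 = 1"
    and K: "K \<ge> 0" and Fp: "\<And>n. n \<ge> 1 \<Longrightarrow> Fp n \<le> K ^ n"
  shows "F g \<le> weight K g"
proof -
  have "F (sum_mset A) \<le> K ^ size A" if "set_mset A \<subseteq> P" for A
    using that
  proof (induction "size A" arbitrary: A rule: less_induct)
    case less
    show ?case
    proof (cases "A = {#}")
      case True
      then show ?thesis using F0 by simp
    next
      case False
      then obtain p where p: "p \<in># A" by auto
      define n where "n = count A p"
      define A' where "A' = filter_mset (\<lambda>x. x \<noteq> p) A"
      have n: "n \<ge> 1" using p by (simp add: n_def Suc_le_eq)
      have A: "A = replicate_mset n p + A'"
        unfolding n_def A'_def by (rule multiset_eqI) auto
      have pP: "p \<in> P" and A'P: "set_mset A' \<subseteq> P" and "p \<notin># A'"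
        using less.prems p by (auto simp: A'_def)
      have rep: "sum_mset (replicate_mset m p) = (\<Sum>i<m. p)" for m
        by (induction m) (auto simp: add.commute)
      have "set_mset (replicate_mset n p) \<subseteq> P" using pP by auto
      then have "coprime_elts P (sum_mset (replicate_mset n p)) (sum_mset A')"
        using A'P \<open>p \<notin># A'\<close> by (auto simp: coprime_elts_def simp del: sum_mset_replicate_mset)
      then have "F (sum_mset A) = F (\<Sum>i<n. p) * F (sum_mset A')"
        using mult unfolding A multiplicative_on_def rep[symmetric] by simp
      also have "\<dots> = Fp n * F (sum_mset A')"
        using ind pP n by (simp add: prime_independent_def)
      also have "\<dots> \<le> K ^ n * K ^ size A'"
        using Fp[OF n] less.hyps[of A'] A'P n K nonneg by (intro mult_mono) (auto simp: A)
      also have "\<dots> = K ^ size A" by (simp add: A power_add)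
      finally show ?thesis .
    qed
  qed
  from this[OF prime_decomp_primes[of g]] show ?thesis by (simp add: weight_def)
qed

end

theorem theorem20:
  fixes deg :: "'a::comm_monoid_add \<Rightarrow> nat" and P :: "'a set"
    and F :: "'a \<Rightarrow> real" and Fp :: "nat \<Rightarrow> real" and R M :: nat
  assumes "additive_arith_semigroup deg P"
    and "R \<ge> 1" and "axiom_W R deg"
    and "warlimont_function P F Fp"
    and "M \<ge> 1"
  shows "\<exists>\<xi> :: nat \<Rightarrow> real.
    (\<lambda>n. (\<Sum>g | deg g = n. (normalization F Fp g - 1) ^ M)
          - (\<Sum>s=1..R-1. \<xi> s * real (num_of_deg deg (n - s))))
      \<in> O(\<lambda>n. real (num_of_deg deg (n - R)))"
proof -
  interpret arith_semigroup_W deg P R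
    using assms by unfold_locales
  have nonneg: "\<And>g. F g \<ge> 0" and mult: "multiplicative_on P F" and ind: "prime_independent P F Fp"
    and log: "(\<lambda>n. ln (Fp n)) \<in> O(\<lambda>n. real n)" and Fp1: "Fp 1 > 0"
    using assms(4) by (auto simp: warlimont_function_def)
  let ?\<phi> = "\<lambda>g. (normalization F Fp g - 1) ^ M"
  have "expandable (\<lambda>n. \<Sum>g | deg g = n. ?\<phi> g)"
  \<comment> \<open>The value \<open>F 0 = 1\<close> is derived from a prime. Without primes the
    semigroup is trivial and the sums vanish for \<open>n \<ge> 1\<close>.\<close>
  proof (cases "P = {}")
    case True
    have "g = 0" for g :: 'a
      using prime_decomp_primes[of g] sum_mset_prime_decomp[of g] True by simp
    then have "{g. deg g = n} = {}" if "n \<ge> 1" for n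
      using that deg_0 by (metis (mono_tags, lifting) Collect_empty_eq not_one_le_zero)
    then have "(\<Sum>g | deg g = n. ?\<phi> g) = 0" if "n \<ge> 1" for n
      using that by (simp only: sum.empty)
    then have "eventually (\<lambda>n. (\<Sum>g | deg g = n. ?\<phi> g) = 0) at_top"
      using eventually_ge_at_top[of 1] by (rule eventually_mono[rotated])
    then have "(\<lambda>n. \<Sum>g | deg g = n. ?\<phi> g) \<in> O(\<lambda>n. a (n - R))"
      by (subst landau_o.big.in_cong) auto
    then show ?thesis by (rule expandable_bigo)
  next
    case False
    then obtain q where q: "q \<in> P" by blast
    have Fprime: "F p = Fp 1" if "p \<in> P" for p
      using bspec[OF ind[unfolded prime_independent_def] that, rule_format, of 1] by simp
    have "F (q + 0) = F q * F 0"
      using mult unfolding multiplicative_on_def coprime_elts_def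
      by (metis inf_bot_right prime_decomp_0 set_mset_empty)
    then have F0: "F 0 = 1" using Fprime[OF q] Fp1 by simp
    obtain K where K: "K \<ge> 1" "\<And>n. n \<ge> 1 \<Longrightarrow> Fp n \<le> K ^ n"
      using log_bounded_imp_power_bound[OF log] by blast
    have FK: "F g \<le> weight K g" for g
      using prime_independent_le_weight[OF mult ind nonneg F0] K by simp
    show ?thesis
    \<comment> \<open>Dividing by \<open>Fp 1\<close> cancels exactly the factor \<open>F p\<close>
      of the large prime, so \<open>\<psi>\<close> is built from \<open>F\<close> without
      normalization and \<open>\<psi> 0 = 0\<close> follows from \<open>F 0 = 1\<close>.\<close>
    proof (rule expandable_sum_coprime_shift)
      fix p h assume p: "p \<in> P" "p \<notin># prime_decomp P h"
      then have "F (p + h) = F p * F h"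
        using mult by (simp add: multiplicative_on_def coprime_elts_def)
      then show "?\<phi> (p + h) = (F h - 1) ^ M"
        using Fprime p Fp1 by (simp add: normalization_def)
    next
      show "K ^ M \<ge> 1" using K by simp
    next
      fix g
      \<comment> \<open>The constant 1 is absorbed by \<open>weight K g \<ge> 1\<close>, and the
        \<open>M\<close>-th power turns \<open>weight K\<close> into
        \<open>weight (K ^ M)\<close>.\<close>
      have "\<bar>normalization F Fp g - 1\<bar> \<le> F g / Fp 1 + 1"
        using nonneg[of g] Fp1 unfolding normalization_def by (smt (verit) divide_nonneg_nonneg)
      also have "\<dots> \<le> weight K g / Fp 1 + weight K g"
        using FK[of g] weight_ge_1[OF K(1)] Fp1 by (intro add_mono divide_right_mono) auto
      finally have "\<bar>?\<phi> g\<bar> \<le> ((1 / Fp 1 + 1) * weight K g) ^ M"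
        unfolding power_abs by (intro power_mono) (auto simp: algebra_simps)
      also have "\<dots> = (1 / Fp 1 + 1) ^ M * weight (K ^ M) g"
        by (simp add: power_mult_distrib weight_def power_mult[symmetric] mult.commute)
      finally show "\<bar>?\<phi> g\<bar> \<le> (1 / Fp 1 + 1) ^ M * weight (K ^ M) g" .
    next
      show "(F 0 - 1) ^ M = 0" using F0 assms(5) by simp
    qed
  qed
  then show ?thesis unfolding expandable_def .
qed

end
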